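(* Let $I \supset [0,\infty)$ be an open interval and let $f : I \to (0,\infty)$ be differentiable. Let $a \in [0,\infty)$, $b \ge 1$, $a<b$, and $m \in (0,1]$. Suppose that $f' \in L[a,b]$, that $|f'|$ is decreasing and $m$-geometrically convex on $[\min\{1,a\},b]$, and that $|f'(y)| \le M \le 1$ for all $y \in [\min\{1,a\},b]$. Then for every $\mu>0$ and every $x \in [a,b]$, $$\left| \frac{(x-a)^{\mu}+(b-x)^{\mu}}{b-a} f(x) - \frac{\Gamma(\mu+1)}{b-a}\left[ J_{x^-}^{\mu} f(a) + J_{x^+}^{\mu} f(b) \right] \right| \le \left[ \frac{(x-a)^{\mu+1}+(b-x)^{\mu+1}}{b-a} \right] k(1),$$ where $$k(1) = \begin{cases} \dfrac{1}{\mu+1}, & M=1,\\[4pt] M^{m} \int_0^1 t^{\mu} M^{(1-m)t}\,dt, & M\neq 1. \end{cases}$$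
   Context: Let $m\in(0,1]$. A positive function $g$ is $m$-geometrically convex on an interval $J\subset[0,\infty)$ if $g\left(x^{t}y^{m(1-t)}\right) \le [g(x)]^{t}[g(y)]^{m(1-t)}$ for all $x,y\in J$ and $t\in[0,1]$. $L[a,b]$ denotes the Lebesgue integrable functions on $[a,b]$, and $\Gamma$ is the Gamma function. The Riemann-Liouville fractional integrals of order $\mu>0$ are $J_{c^+}^{\mu} f(x)=\frac{1}{\Gamma(\mu)}\int_c^x (x-t)^{\mu-1}f(t)\,dt$ for $x>c$ and $J_{d^-}^{\mu} f(x)=\frac{1}{\Gamma(\mu)}\int_x^d (t-x)^{\mu-1}f(t)\,dt$ for $x<d$. Thus $J_{x^-}^{\mu} f(a)=\frac{1}{\Gamma(\mu)}\int_a^x (t-a)^{\mu-1}f(t)\,dt$ and $J_{x^+}^{\mu} f(b)=\frac{1}{\Gamma(\mu)}\int_x^b (b-t)^{\mu-1}f(t)\,dt$ (each being $0$ when the integration interval is a point). *)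

theory Defs
  imports "HOL-Analysis.Analysis"
begin

text \<open>
  \<^const>\<open>powr\<close> satisfies \<open>0 powr 0 = 0\<close>. Below, intervals may contain \<open>0\<close> and exponents
  may vanish, and the usual convention \<open>0\<^sup>0 = 1\<close> is meant.
\<close>

definition rpow :: "real \<Rightarrow> real \<Rightarrow> real" where
  "rpow x p = (if p = 0 then 1 else x powr p)"

text \<open>
  Intended for \<open>0 < m \<le> 1\<close> and intervals \<open>J\<close> of nonnegative reals. If moreover \<open>1 \<in> J\<close>, then
  the argument of \<open>g\<close> on the left-hand side of the inequality always lies in \<open>J\<close>.
\<close>

definition m_geometrically_convex_on :: "real \<Rightarrow> real set \<Rightarrow> (real \<Rightarrow> real) \<Rightarrow> bool" where
  "m_geometrically_convex_on m J g \<longleftrightarrow>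
     (\<forall>x\<in>J. g x > 0) \<and>
     (\<forall>x\<in>J. \<forall>y\<in>J. \<forall>t\<in>{0..1}.
        g (rpow x t * rpow y (m * (1 - t))) \<le> rpow (g x) t * rpow (g y) (m * (1 - t)))"

text \<open>
  Riemann--Liouville fractional integrals of order \<open>\<mu> > 0\<close>: \<open>RL_left \<mu> c f x\<close> is
  \<open>(J\<^bsub>c+\<^esub>\<^bsup>\<mu>\<^esup> f)(x)\<close> and \<open>RL_right \<mu> d f x\<close> is \<open>(J\<^bsub>d-\<^esub>\<^bsup>\<mu>\<^esup> f)(x)\<close>.
  The value of the kernel at the endpoint \<open>t = x\<close> is irrelevant, and both integrals
  are \<open>0\<close> when the interval is a point.
\<close>

definition RL_left :: "real \<Rightarrow> real \<Rightarrow> (real \<Rightarrow> real) \<Rightarrow> real \<Rightarrow> real" where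
  "RL_left \<mu> c f x =
     1 / Gamma \<mu> * (LINT t:{c..x}|lebesgue. (x - t) powr (\<mu> - 1) * f t)"

definition RL_right :: "real \<Rightarrow> real \<Rightarrow> (real \<Rightarrow> real) \<Rightarrow> real \<Rightarrow> real" where
  "RL_right \<mu> d f x =
     1 / Gamma \<mu> * (LINT t:{x..d}|lebesgue. (t - x) powr (\<mu> - 1) * f t)"

end

theory Submission
  imports Defs
begin

text \<open>
  The weight \<open>\<mu> (t - a) powr (\<mu> - 1)\<close> has total mass \<open>(x - a) powr \<mu>\<close> on \<open>[a, x]\<close>, so
  the left half of the expression is the integral of this weight against \<open>f x - f t\<close>, and by the
  mean value theorem it is at most \<open>M (x - a) powr (\<mu> + 1) / (\<mu> + 1)\<close>; the right half is
  symmetric. Since \<open>0 < M \<le> 1\<close> and \<open>m + (1 - m) t \<le> 1\<close>, we have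
  \<open>M \<le> M powr (m + (1 - m) t)\<close>, which turns the factor \<open>M / (\<mu> + 1)\<close> into \<open>k(1)\<close>.
\<close>

text \<open>For \<open>p < 0\<close> the integrand is unbounded near \<open>a\<close>, so the
  fundamental theorem is used in its interior form: since \<open>p + 1 > 0\<close>, the
  antiderivative is continuous up to \<open>a\<close>, where it vanishes, and it is differentiated
  only inside.\<close>

lemma has_integral_powr_left_endpoint:
  fixes a x p :: real
  assumes "p > -1" "a \<le> x"
  shows "((\<lambda>t. (t - a) powr p) has_integral (x - a) powr (p + 1) / (p + 1)) {a..x}"
proof -
  have "((\<lambda>t. (t - a) powr p) has_integral
      ((x - a) powr (p + 1) / (p + 1) - (a - a) powr (p + 1) / (p + 1))) {a..x}"
  proof (rule fundamental_theorem_of_calculus_interior[OF assms(2)])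
    show "continuous_on {a..x} (\<lambda>t. (t - a) powr (p + 1) / (p + 1))"
      using assms by (auto intro!: continuous_intros continuous_on_powr')
    show "((\<lambda>t. (t - a) powr (p + 1) / (p + 1)) has_vector_derivative (t - a) powr p) (at t)"
      if "t \<in> {a<..<x}" for t
      using that assms
      by (auto intro!: derivative_eq_intros
          simp flip: has_real_derivative_iff_has_vector_derivative)
  qed
  then show ?thesis by simp
qed

text \<open>The reflection \<open>t \<mapsto> - t\<close> moves the singular endpoint
  \<open>b\<close> to the left endpoint \<open>- b\<close>.\<close>

lemma has_integral_powr_right_endpoint:
  fixes b x p :: real
  assumes "p > -1" "x \<le> b"
  shows "((\<lambda>t. (b - t) powr p) has_integral (b - x) powr (p + 1) / (p + 1)) {x..b}"
proof -
  have "((\<lambda>t. (t - (- b)) powr p) has_integral (b - x) powr (p + 1) / (p + 1)) {- b..- x}"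
    using has_integral_powr_left_endpoint[of p "- b" "- x"] assms by simp
  then show ?thesis
    using has_integral_reflect_real[where f = "\<lambda>t. (b - t) powr p"]
    by (simp add: add.commute)
qed

text \<open>As \<open>A\<close> is the total mass of \<open>w\<close>, the difference is the
  integral of \<open>w t * (f x - f t)\<close>, and the Lipschitz bound applies under the integral
  sign. The weight may be unbounded.\<close>

lemma weighted_integral_deviation_bound:
  fixes f w :: "real \<Rightarrow> real" and c d x A B M :: real
  assumes w_nonneg: "\<And>t. t \<in> {c..d} \<Longrightarrow> 0 \<le> w t"
    and w: "(w has_integral A) {c..d}"
    and w_dist: "((\<lambda>t. w t * \<bar>x - t\<bar>) has_integral B) {c..d}"
    and f: "continuous_on {c..d} f"
    and lip: "\<And>t. t \<in> {c..d} \<Longrightarrow> \<bar>f x - f t\<bar> \<le> M * \<bar>x - t\<bar>"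
  shows "\<bar>A * f x - (LINT t:{c..d}|lebesgue. w t * f t)\<bar> \<le> M * B"
proof -
  have "w absolutely_integrable_on {c..d}"
    using w w_nonneg by (intro nonnegative_absolutely_integrable_1) auto
  \<comment> \<open>\<open>f\<close> is bounded and measurable, being continuous on a compact
    interval.\<close>
  then have "(\<lambda>t. f t * w t) absolutely_integrable_on {c..d}"
    using f by (intro absolutely_integrable_bounded_measurable_product_real
        continuous_imp_measurable_on_sets_lebesgue compact_imp_bounded
        compact_continuous_image) auto
  then have wf: "(\<lambda>t. w t * f t) absolutely_integrable_on {c..d}"
    by (simp add: mult.commute)
  have "((\<lambda>t. w t * f t) has_integral (LINT t:{c..d}|lebesgue. w t * f t)) {c..d}"
    using has_integral_set_lebesgue[OF wf] by simp
  from has_integral_diff[OF has_integral_mult_left[OF w, of "f x"] this]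
  have diff: "((\<lambda>t. w t * (f x - f t)) has_integral
      (A * f x - (LINT t:{c..d}|lebesgue. w t * f t))) {c..d}"
    by (simp add: algebra_simps)
  have bound: "norm (w t * (f x - f t)) \<le> M * (w t * \<bar>x - t\<bar>)" if "t \<in> {c..d}" for t
    using mult_left_mono[OF lip[OF that] w_nonneg[OF that]] w_nonneg[OF that]
    by (simp add: abs_mult mult.left_commute)
  have dist: "((\<lambda>t. M * (w t * \<bar>x - t\<bar>)) has_integral M * B) {c..d}"
    by (rule has_integral_mult_right[OF w_dist])
  from integral_norm_bound_integral[OF has_integral_integrable[OF diff]
      has_integral_integrable[OF dist] bound]
  show ?thesis
    unfolding integral_unique[OF diff] integral_unique[OF dist] by simp
qed

text \<open>
  Here \<open>s t\<close> is the distance from \<open>t\<close> to the endpoint at which the fractional integral is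
  evaluated, and \<open>r\<close> that of the base point \<open>x\<close>, so both one-sided integrals are instances.
\<close>

lemma fractional_kernel_deviation_bound:
  fixes f s :: "real \<Rightarrow> real" and c d x r M \<mu> :: real
  assumes \<mu>: "\<mu> > 0" and r: "0 \<le> r"
    and s_nonneg: "\<And>t. t \<in> {c..d} \<Longrightarrow> 0 \<le> s t"
    and s_dist: "\<And>t. t \<in> {c..d} \<Longrightarrow> \<bar>x - t\<bar> = r - s t"
    and s_int: "\<And>p. p > -1 \<Longrightarrow>
      ((\<lambda>t. s t powr p) has_integral r powr (p + 1) / (p + 1)) {c..d}"
    and f: "continuous_on {c..d} f"
    and lip: "\<And>t. t \<in> {c..d} \<Longrightarrow> \<bar>f x - f t\<bar> \<le> M * \<bar>x - t\<bar>"
  shows "\<bar>r powr \<mu> * f x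
      - Gamma (\<mu> + 1) * (1 / Gamma \<mu> * (LINT t:{c..d}|lebesgue. s t powr (\<mu> - 1) * f t))\<bar>
    \<le> M * (r powr (\<mu> + 1) / (\<mu> + 1))"
proof -
  let ?w = "\<lambda>t. s t powr (\<mu> - 1)"
  let ?L = "LINT t:{c..d}|lebesgue. ?w t * f t"
  have w: "(?w has_integral r powr \<mu> / \<mu>) {c..d}"
    using s_int[of "\<mu> - 1"] \<mu> by simp
  \<comment> \<open>This integrand is \<open>?w t * (r - s t)\<close>, the weight times the distance
    from \<open>t\<close> to \<open>x\<close>.\<close>
  have "((\<lambda>t. r * ?w t - s t powr \<mu>) has_integral
      (r * (r powr \<mu> / \<mu>) - r powr (\<mu> + 1) / (\<mu> + 1))) {c..d}"
    using s_int[of \<mu>] \<mu> w by (intro has_integral_diff has_integral_mult_right) auto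
  also have "r * (r powr \<mu> / \<mu>) = r powr (\<mu> + 1) / \<mu>"
    using r by (simp add: powr_mult_base add.commute)
  finally have "((\<lambda>t. ?w t * \<bar>x - t\<bar>) has_integral
      (r powr (\<mu> + 1) / \<mu> - r powr (\<mu> + 1) / (\<mu> + 1))) {c..d}"
  proof (rule has_integral_eq[rotated])
    fix t assume t: "t \<in> {c..d}"
    \<comment> \<open>At the singular point \<open>s t = 0\<close> both sides are \<open>0\<close>,
      because \<open>0 powr \<mu> = 0\<close>.\<close>
    then have "s t powr \<mu> = s t * ?w t"
      using s_nonneg by (simp add: powr_mult_base)
    then show "r * ?w t - s t powr \<mu> = ?w t * \<bar>x - t\<bar>"
      unfolding s_dist[OF t] by (simp add: algebra_simps)
  qed
  from weighted_integral_deviation_bound[OF _ w this f lip]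
  have "\<bar>r powr \<mu> / \<mu> * f x - ?L\<bar>
      \<le> M * (r powr (\<mu> + 1) / \<mu> - r powr (\<mu> + 1) / (\<mu> + 1))"
    by simp
  \<comment> \<open>The factor \<open>\<mu>\<close> is
    \<open>Gamma (\<mu> + 1) / Gamma \<mu>\<close>. On the right it turns
    \<open>1 / \<mu> - 1 / (\<mu> + 1)\<close> into \<open>1 / (\<mu> + 1)\<close>.\<close>
  then have "\<mu> * \<bar>r powr \<mu> / \<mu> * f x - ?L\<bar>
      \<le> \<mu> * (M * (r powr (\<mu> + 1) / \<mu> - r powr (\<mu> + 1) / (\<mu> + 1)))"
    using \<mu> by (intro mult_left_mono) auto
  also have "\<dots> = M * (r powr (\<mu> + 1) / (\<mu> + 1))"
    using \<mu> by (simp add: divide_simps) (simp add: algebra_simps)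
  also have "\<mu> * \<bar>r powr \<mu> / \<mu> * f x - ?L\<bar> = \<bar>\<mu> * (r powr \<mu> / \<mu> * f x - ?L)\<bar>"
    using \<mu> by (simp add: abs_mult)
  also have "\<mu> * (r powr \<mu> / \<mu> * f x - ?L) =
      r powr \<mu> * f x - Gamma (\<mu> + 1) * (1 / Gamma \<mu> * ?L)"
  proof -
    have "Gamma (\<mu> + 1) = \<mu> * Gamma \<mu>"
      using \<mu> by (auto intro!: Gamma_plus1 elim!: nonpos_Ints_cases)
    moreover have "Gamma \<mu> \<noteq> 0"
      using Gamma_real_pos[OF \<mu>] by linarith
    ultimately show ?thesis
      using \<mu> by (simp add: right_diff_distrib)
  qed
  finally show ?thesis .
qed

lemma RL_right_deviation_bound:
  fixes f :: "real \<Rightarrow> real" and a x M \<mu> :: real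
  assumes "\<mu> > 0" "a \<le> x" "continuous_on {a..x} f"
    and "\<And>t. t \<in> {a..x} \<Longrightarrow> \<bar>f x - f t\<bar> \<le> M * \<bar>x - t\<bar>"
  shows "\<bar>(x - a) powr \<mu> * f x - Gamma (\<mu> + 1) * RL_right \<mu> x f a\<bar>
    \<le> M * ((x - a) powr (\<mu> + 1) / (\<mu> + 1))"
  unfolding RL_right_def
  using assms by (intro fractional_kernel_deviation_bound has_integral_powr_left_endpoint) auto

lemma RL_left_deviation_bound:
  fixes f :: "real \<Rightarrow> real" and b x M \<mu> :: real
  assumes "\<mu> > 0" "x \<le> b" "continuous_on {x..b} f"
    and "\<And>t. t \<in> {x..b} \<Longrightarrow> \<bar>f x - f t\<bar> \<le> M * \<bar>x - t\<bar>"
  shows "\<bar>(b - x) powr \<mu> * f x - Gamma (\<mu> + 1) * RL_left \<mu> x f b\<bar>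
    \<le> M * ((b - x) powr (\<mu> + 1) / (\<mu> + 1))"
  unfolding RL_left_def
  using assms by (intro fractional_kernel_deviation_bound has_integral_powr_right_endpoint) auto

lemma M_le_powr_kernel_integral:
  fixes M m \<mu> :: real
  assumes "0 < M" "M \<le> 1" "m \<le> 1" "\<mu> > 0"
  shows "M / (\<mu> + 1)
    \<le> M powr m * (LINT t:{0..1}|lebesgue. t powr \<mu> * M powr ((1 - m) * t))"
proof -
  let ?k = "\<lambda>t. t powr \<mu> * M powr ((1 - m) * t)"
  have "continuous_on {0..1} ?k"
    using assms by (auto intro!: continuous_intros continuous_on_powr')
  then have "?k absolutely_integrable_on {0..1}"
    by (rule absolutely_integrable_continuous_real)
  then have "(?k has_integral (LINT t:{0..1}|lebesgue. ?k t)) {0..1}"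
    using has_integral_set_lebesgue by blast
  then have k: "((\<lambda>t. M powr m * ?k t) has_integral
      M powr m * (LINT t:{0..1}|lebesgue. ?k t)) {0..1}"
    by (rule has_integral_mult_right)
  have "((\<lambda>t. M * t powr \<mu>) has_integral M * (1 / (\<mu> + 1))) {0..1}"
    using has_integral_powr_left_endpoint[of \<mu> 0 1] assms
    by (intro has_integral_mult_right) simp
  then have "M * (1 / (\<mu> + 1)) \<le> M powr m * (LINT t:{0..1}|lebesgue. ?k t)"
  proof (rule has_integral_le[OF _ k])
    fix t :: real assume t: "t \<in> {0..1}"
    have "(1 - m) * t \<le> (1 - m) * 1"
      using t assms by (intro mult_left_mono) auto
    \<comment> \<open>With base in \<open>(0, 1]\<close> the power decreases in the exponent, and
      \<open>m + (1 - m) * t \<le> 1\<close>.\<close>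
    then have "M powr 1 \<le> M powr (m + (1 - m) * t)"
      using assms by (intro powr_mono') auto
    then have "M * t powr \<mu> \<le> M powr (m + (1 - m) * t) * t powr \<mu>"
      using assms by (intro mult_right_mono) auto
    then show "M * t powr \<mu> \<le> M powr m * ?k t"
      by (simp add: powr_add mult_ac)
  qed
  then show ?thesis by simp
qed

theorem corollary1:
  fixes I :: "real set" and f :: "real \<Rightarrow> real" and a b m M \<mu> x :: real
  assumes "open I" and "is_interval I" and "{0..} \<subseteq> I"
    and "\<And>y. y \<in> I \<Longrightarrow> f y > 0"
    and "f differentiable_on I"
    and "a \<ge> 0" and "b \<ge> 1" and "a < b"
    and "0 < m" and "m \<le> 1"
    and "set_integrable lebesgue {a..b} (deriv f)"
    and "antimono_on {min 1 a..b} (\<lambda>y. \<bar>deriv f y\<bar>)"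
    and "m_geometrically_convex_on m {min 1 a..b} (\<lambda>y. \<bar>deriv f y\<bar>)"
    and "\<And>y. y \<in> {min 1 a..b} \<Longrightarrow> \<bar>deriv f y\<bar> \<le> M" and "M \<le> 1"
    and "\<mu> > 0" and "x \<in> {a..b}"
  shows "\<bar>((x - a) powr \<mu> + (b - x) powr \<mu>) / (b - a) * f x
           - Gamma (\<mu> + 1) / (b - a) * (RL_right \<mu> x f a + RL_left \<mu> x f b)\<bar>
         \<le> ((x - a) powr (\<mu> + 1) + (b - x) powr (\<mu> + 1)) / (b - a) *
           (if M = 1 then 1 / (\<mu> + 1)
            else M powr m * (LINT t:{0..1}|lebesgue. t powr \<mu> * M powr ((1 - m) * t)))"
proof -
  \<comment> \<open>Positivity of \<open>\<bar>deriv f\<bar>\<close> is part of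
    \<open>m_geometrically_convex_on\<close>; it is read off at \<open>b\<close>.\<close>
  have M_pos: "0 < M"
  proof -
    have "b \<in> {min 1 a..b}" using assms(7) by auto
    then have "0 < \<bar>deriv f b\<bar>" "\<bar>deriv f b\<bar> \<le> M"
      using assms(13,14) unfolding m_geometrically_convex_on_def by blast+
    then show ?thesis by linarith
  qed
  \<comment> \<open>Openness of \<open>I\<close> makes the derivative two-sided, even at the
    endpoints of \<open>{a..b}\<close>.\<close>
  have deriv: "(f has_field_derivative deriv f y) (at y)" if "y \<in> {a..b}" for y
    using that assms(1,3,5,6)
    by (auto simp: DERIV_deriv_iff_real_differentiable differentiable_on_eq_differentiable_at
        subset_iff)
  then have cont: "continuous_on {a..b} f"
    by (meson DERIV_isCont continuous_at_imp_continuous_on)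
  have lip: "\<bar>f x - f t\<bar> \<le> M * \<bar>x - t\<bar>" if "t \<in> {a..b}" for t
  proof -
    \<comment> \<open>Mean value bound; \<open>\<bar>deriv f\<bar> \<le> M\<close> is available
      since \<open>{a..b}\<close> lies in \<open>{min 1 a..b}\<close>.\<close>
    have "norm (f x - f t) \<le> M * norm (x - t)"
      using deriv assms(14,17) that
      by (intro field_differentiable_bound[of "{a..b}" f "deriv f"])
        (auto intro: has_field_derivative_at_within)
    then show ?thesis by simp
  qed
  let ?P = "(x - a) powr (\<mu> + 1)" and ?Q = "(b - x) powr (\<mu> + 1)"
  let ?k = "if M = 1 then 1 / (\<mu> + 1)
    else M powr m * (LINT t:{0..1}|lebesgue. t powr \<mu> * M powr ((1 - m) * t))"
  let ?U = "(x - a) powr \<mu> * f x - Gamma (\<mu> + 1) * RL_right \<mu> x f a"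
  let ?V = "(b - x) powr \<mu> * f x - Gamma (\<mu> + 1) * RL_left \<mu> x f b"
  have "\<bar>?U\<bar> \<le> M * (?P / (\<mu> + 1))"
    using assms(16,17) by (intro RL_right_deviation_bound lip continuous_on_subset[OF cont]) auto
  moreover have "\<bar>?V\<bar> \<le> M * (?Q / (\<mu> + 1))"
    using assms(16,17) by (intro RL_left_deviation_bound lip continuous_on_subset[OF cont]) auto
  ultimately have "\<bar>?U + ?V\<bar> \<le> M * (?P / (\<mu> + 1)) + M * (?Q / (\<mu> + 1))"
    by linarith
  also have "\<dots> = (?P + ?Q) * (M / (\<mu> + 1))"
    by (simp add: algebra_simps add_divide_distrib)
  \<comment> \<open>For \<open>M = 1\<close> the two factors agree; otherwise
    \<open>M_le_powr_kernel_integral\<close> compares them.\<close>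
  also have "\<dots> \<le> (?P + ?Q) * ?k"
    using M_le_powr_kernel_integral[of M m \<mu>] M_pos assms(10,15,16)
    by (intro mult_left_mono) auto
  finally have "\<bar>?U + ?V\<bar> / (b - a) \<le> (?P + ?Q) * ?k / (b - a)"
    using assms(8) by (intro divide_right_mono) auto
  moreover have "((x - a) powr \<mu> + (b - x) powr \<mu>) / (b - a) * f x
      - Gamma (\<mu> + 1) / (b - a) * (RL_right \<mu> x f a + RL_left \<mu> x f b) = (?U + ?V) / (b - a)"
    by (simp add: algebra_simps add_divide_distrib diff_divide_distrib)
  ultimately show ?thesis
    using assms(8) by (simp only: abs_divide times_divide_eq_left abs_of_pos diff_gt_0_iff_gt)
qed

end
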